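(* Let $r\ge 4$ and $q\ge 1$ be integers. Let $J$ be a graph with $n=|V(J)|$ and $m=\chi(J)>q$, and put $$M_q=\frac{(m-q)^2}{2q}.$$ Suppose there is $p\in(0,1]$ such that $$pM_q\ge 16(n\log q+\log 4)\qquad\text{and}\qquad \sum_{\ell=3}^{r-1}p^\ell C_\ell(J)\le \frac{pM_q}{16}.$$ Then $J$ contains a subgraph $H$ with $\operatorname{girth}(H)\ge r$ and $\chi(H)\ge q+1$.
   Context: All graphs are finite and simple; subgraphs need not be induced. $\chi$ is the chromatic number; the girth of a forest is $\infty$; $\log$ is natural. $C_\ell(J)$ is the number of cycles of length $\ell$ in $J$, counted as unoriented simple subgraphs. *)

theory Defs
  imports Complex_Main "HOL-Library.Extended_Nat"
begin

type_synonym 'a ugraph = "'a set \<times> 'a set set"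

abbreviation uverts :: "'a ugraph \<Rightarrow> 'a set" where
  "uverts G \<equiv> fst G"

abbreviation uedges :: "'a ugraph \<Rightarrow> 'a set set" where
  "uedges G \<equiv> snd G"

definition fin_simple_graph :: "'a ugraph \<Rightarrow> bool" where
  "fin_simple_graph G \<longleftrightarrow>
     finite (uverts G) \<and> (\<forall>e\<in>uedges G. e \<subseteq> uverts G \<and> card e = 2)"

text \<open>Subgraphs are not required to be induced.\<close>

definition subgraph_of :: "'a ugraph \<Rightarrow> 'a ugraph \<Rightarrow> bool" where
  "subgraph_of H G \<longleftrightarrow>
     fin_simple_graph H \<and> uverts H \<subseteq> uverts G \<and> uedges H \<subseteq> uedges G"

definition proper_coloring :: "'a ugraph \<Rightarrow> nat \<Rightarrow> ('a \<Rightarrow> nat) \<Rightarrow> bool" where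
  "proper_coloring G k c \<longleftrightarrow>
     (\<forall>v\<in>uverts G. c v < k) \<and> (\<forall>u v. {u, v} \<in> uedges G \<longrightarrow> c u \<noteq> c v)"

definition chromatic_number :: "'a ugraph \<Rightarrow> nat" where
  "chromatic_number G = (LEAST k. \<exists>c. proper_coloring G k c)"

text \<open>A cycle is itself a graph, i.e. an unoriented object without base point; the list
  \<open>vs\<close> is one of its \<open>2 * l\<close> cyclic traversals.\<close>

definition is_cycle :: "nat \<Rightarrow> 'a ugraph \<Rightarrow> bool" where
  "is_cycle l C \<longleftrightarrow>
     (\<exists>vs. length vs = l \<and> 3 \<le> l \<and> distinct vs \<and>
        C = (set vs, {{vs ! i, vs ! (Suc i mod l)} | i. i < l}))"

definition cycle_count :: "nat \<Rightarrow> 'a ugraph \<Rightarrow> nat" where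
  "cycle_count l G = card {C. subgraph_of C G \<and> is_cycle l C}"

text \<open>In \<open>enat\<close> the infimum of the empty set is \<open>\<infinity>\<close>, so forests have infinite girth.\<close>

definition girth :: "'a ugraph \<Rightarrow> enat" where
  "girth G = (INF l \<in> {l. \<exists>C. subgraph_of C G \<and> is_cycle l C}. enat l)"

end

theory Submission
  imports Defs "HOL-Library.FuncSet"
begin

text \<open>Every map \<open>c\<close> from the vertices to \<open>q\<close> colours leaves at least \<open>M\<close> monochromatic edges in
  \<open>J\<close>. Keep each edge independently with probability \<open>p\<close>, and put \<open>t = p M / 4\<close>. If \<open>Y\<close> is the number of
  surviving cycles shorter than \<open>r\<close> and \<open>X c\<close> the number of surviving edges that are monochromatic under
  \<open>c\<close>, then \<open>Y / t + (\<Sum>c. 2 powr (t - X c))\<close> has expectation below 1, so some outcome has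
  \<open>Y < t < X c\<close> for all \<open>c\<close>. Deleting one edge from each surviving short cycle destroys these cycles but
  leaves a monochromatic edge under every \<open>c\<close>.\<close>

section \<open>Finite graphs, proper maps and the chromatic number\<close>

definition mono_edges :: "'a ugraph \<Rightarrow> ('a \<Rightarrow> nat) \<Rightarrow> 'a set set" where
  "mono_edges G c = {e \<in> uedges G. \<forall>u\<in>e. \<forall>v\<in>e. c u = c v}"

lemma finite_uedges:
  assumes "fin_simple_graph G"
  shows "finite (uedges G)"
proof (rule finite_subset)
  show "uedges G \<subseteq> Pow (uverts G)" using assms by (auto simp: fin_simple_graph_def)
  show "finite (Pow (uverts G))" using assms by (auto simp: fin_simple_graph_def)
qed

lemma finite_subgraphs:
  assumes "fin_simple_graph G"
  shows "finite {C. subgraph_of C G}"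
proof (rule finite_subset)
  show "{C. subgraph_of C G} \<subseteq> Pow (uverts G) \<times> Pow (uedges G)"
    by (auto simp: subgraph_of_def)
  show "finite (Pow (uverts G) \<times> Pow (uedges G))"
    using assms finite_uedges[OF assms] by (auto simp: fin_simple_graph_def)
qed

lemma edge_distinct:
  assumes "fin_simple_graph G" "{u, v} \<in> uedges G"
  shows "u \<noteq> v"
proof
  assume "u = v"
  then have "card {u, v} = 1" by simp
  moreover have "card {u, v} = 2" using assms unfolding fin_simple_graph_def by blast
  ultimately show False by simp
qed

text \<open>The values of \<open>g\<close> may be arbitrary naturals. Composing with a bijection
  from its image onto an initial segment turns it into a colouring in the sense of
  \<open>proper_coloring\<close>.\<close>

lemma ex_proper_coloring_card_image:
  fixes g :: "'a \<Rightarrow> nat"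
  assumes G: "fin_simple_graph G"
    and proper: "\<And>u v. {u, v} \<in> uedges G \<Longrightarrow> g u \<noteq> g v"
  shows "\<exists>c. proper_coloring G (card (g ` uverts G)) c"
proof -
  have fin: "finite (g ` uverts G)" using G by (simp add: fin_simple_graph_def)
  obtain h where h: "bij_betw h (g ` uverts G) {0..<card (g ` uverts G)}"
    using ex_bij_betw_finite_nat[OF fin] by blast
  have inj: "inj_on h (g ` uverts G)" using h by (rule bij_betw_imp_inj_on)
  have "proper_coloring G (card (g ` uverts G)) (h \<circ> g)"
    unfolding proper_coloring_def
  proof (intro conjI ballI allI impI)
    fix v assume "v \<in> uverts G"
    then show "(h \<circ> g) v < card (g ` uverts G)"
      using h by (auto simp: bij_betw_def)
  next
    fix u v assume e: "{u, v} \<in> uedges G"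
    then have "{u, v} \<subseteq> uverts G" using G unfolding fin_simple_graph_def by blast
    then show "(h \<circ> g) u \<noteq> (h \<circ> g) v"
      using proper[OF e] inj by (auto dest: inj_onD)
  qed
  then show ?thesis by blast
qed

lemma chromatic_number_le_card_image:
  fixes g :: "'a \<Rightarrow> nat"
  assumes "fin_simple_graph G" and "\<And>u v. {u, v} \<in> uedges G \<Longrightarrow> g u \<noteq> g v"
  shows "chromatic_number G \<le> card (g ` uverts G)"
  unfolding chromatic_number_def by (intro Least_le ex_proper_coloring_card_image assms)

lemma ex_injective_proper_map:
  fixes G :: "'a ugraph"
  assumes G: "fin_simple_graph G"
  shows "\<exists>h :: 'a \<Rightarrow> nat. inj_on h (uverts G) \<and> (\<forall>u v. {u, v} \<in> uedges G \<longrightarrow> h u \<noteq> h v)"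
proof -
  obtain h :: "'a \<Rightarrow> nat" where h: "inj_on h (uverts G)"
    using G finite_imp_inj_to_nat_seg[of "uverts G"] unfolding fin_simple_graph_def by blast
  have "h u \<noteq> h v" if e: "{u, v} \<in> uedges G" for u v
  proof -
    have "{u, v} \<subseteq> uverts G" using e G unfolding fin_simple_graph_def by blast
    then show ?thesis using edge_distinct[OF G e] h by (auto dest: inj_onD)
  qed
  then show ?thesis using h by blast
qed

text \<open>A \<open>LEAST\<close> is attained only if some witness exists; an injective map on the
  vertices provides one.\<close>

lemma ex_chromatic_coloring:
  assumes G: "fin_simple_graph G"
  shows "\<exists>c. proper_coloring G (chromatic_number G) c"
proof -
  obtain h :: "'a \<Rightarrow> nat" where "\<And>u v. {u, v} \<in> uedges G \<Longrightarrow> h u \<noteq> h v"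
    using ex_injective_proper_map[OF G] by blast
  then have "\<exists>k c. proper_coloring G k c" using ex_proper_coloring_card_image[OF G] by blast
  then show ?thesis unfolding chromatic_number_def by (rule LeastI_ex)
qed

section \<open>Lower bound on the number of monochromatic edges\<close>

lemma card_Times_minus_Id:
  assumes "finite A"
  shows "real (card (A \<times> A - Id)) = (real (card A))\<^sup>2 - real (card A)"
proof -
  have "A \<times> A - Id = A \<times> A - (\<lambda>x. (x, x)) ` A" by auto
  moreover have "card ((\<lambda>x. (x, x)) ` A) = card A" by (rule card_image) (auto intro: inj_onI)
  moreover have "card (A \<times> A - (\<lambda>x. (x, x)) ` A) = card (A \<times> A) - card ((\<lambda>x. (x, x)) ` A)"
    using assms by (intro card_Diff_subset) auto
  \<comment> \<open>This keeps the natural-number subtraction from truncating when it is moved to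
    the reals.\<close>
  moreover have "card A \<le> card A * card A" by (cases "card A") auto
  ultimately show ?thesis by (simp add: card_cartesian_product power2_eq_square of_nat_diff)
qed

lemma card_ordered_edges_le:
  assumes G: "fin_simple_graph G" and F: "F \<subseteq> uedges G"
  shows "card {(u, v). {u, v} \<in> F} \<le> 2 * card F"
    and "finite {(u, v). {u, v} \<in> F}"
proof -
  have finF: "finite F" using F finite_uedges[OF G] by (rule finite_subset)
  have eq: "{(u, v). {u, v} \<in> F} = (\<Union>e\<in>F. {(u, v). {u, v} = e})" by auto
  have each: "finite {(u, v). {u, v} = e} \<and> card {(u, v). {u, v} = e} \<le> 2" if "e \<in> F" for e
  proof -
    have "card e = 2" using that F G unfolding fin_simple_graph_def by blast
    then obtain x y where "e = {x, y}" by (meson card_2_iff)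
    then have "{(u, v). {u, v} = e} \<subseteq> set [(x, y), (y, x)]"
      by (auto simp: doubleton_eq_iff)
    moreover have "card (set [(x, y), (y, x)]) \<le> 2"
      using card_length[of "[(x, y), (y, x)]"] by simp
    ultimately show ?thesis
      by (metis (no_types, lifting) List.finite_set card_mono finite_subset le_trans)
  qed
  show "finite {(u, v). {u, v} \<in> F}" unfolding eq using finF each by blast
  have "card {(u, v). {u, v} \<in> F} \<le> (\<Sum>e\<in>F. card {(u, v). {u, v} = e})"
    unfolding eq by (rule card_UN_le[OF finF])
  also have "\<dots> \<le> (\<Sum>e\<in>F. 2)" using each by (intro sum_mono) blast
  finally show "card {(u, v). {u, v} \<in> F} \<le> 2 * card F" by simp
qed

text \<open>A proper refinement of \<open>c\<close> using the fewest colours has an edge between any two of its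
  classes that lie in the same class of \<open>c\<close>, since otherwise these two could be merged.\<close>

lemma ex_minimal_proper_refinement:
  fixes c :: "'a \<Rightarrow> nat"
  assumes G: "fin_simple_graph G"
  shows "\<exists>g :: 'a \<Rightarrow> nat. (\<forall>u v. {u, v} \<in> uedges G \<longrightarrow> g u \<noteq> g v)
    \<and> (\<forall>u\<in>uverts G. \<forall>v\<in>uverts G. g u = g v \<longrightarrow> c u = c v)
    \<and> (\<forall>x\<in>uverts G. \<forall>y\<in>uverts G. c x = c y \<longrightarrow> g x \<noteq> g y \<longrightarrow>
          (\<exists>u v. {u, v} \<in> uedges G \<and> g u = g x \<and> g v = g y))"
proof -
  let ?V = "uverts G"
  define P where "P g \<longleftrightarrow> (\<forall>u v. {u, v} \<in> uedges G \<longrightarrow> g u \<noteq> g v)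
    \<and> (\<forall>u\<in>?V. \<forall>v\<in>?V. g u = g v \<longrightarrow> c u = c v)" for g :: "'a \<Rightarrow> nat"
  have fin: "finite ?V" using G by (simp add: fin_simple_graph_def)
  obtain h :: "'a \<Rightarrow> nat" where "inj_on h ?V" "\<And>u v. {u, v} \<in> uedges G \<Longrightarrow> h u \<noteq> h v"
    using ex_injective_proper_map[OF G] by blast
  \<comment> \<open>An injective map refines every \<open>c\<close>, so a refinement with the fewest
    values exists.\<close>
  then have "P h" unfolding P_def by (metis inj_onD)
  then obtain g where g: "P g" and min: "\<And>g'. P g' \<Longrightarrow> card (g ` ?V) \<le> card (g' ` ?V)"
    using ex_has_least_nat[of P h "\<lambda>g. card (g ` ?V)"] by blast
  have merge: "\<exists>u v. {u, v} \<in> uedges G \<and> g u = g x \<and> g v = g y"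
    if xy: "x \<in> ?V" "y \<in> ?V" "c x = c y" "g x \<noteq> g y" for x y
  proof (rule ccontr)
    assume no: "\<not> ?thesis"
    \<comment> \<open>Merge the class of \<open>x\<close> into that of \<open>y\<close>. The map
      stays proper because no edge joins the two classes, still refines \<open>c\<close> because
      \<open>c x = c y\<close>, and loses the value \<open>g x\<close>.\<close>
    define g' where "g' v = (if g v = g x then g y else g v)" for v
    have "P g'" unfolding P_def
    proof (intro conjI allI impI ballI)
      fix u v assume e: "{u, v} \<in> uedges G"
      then have e': "{v, u} \<in> uedges G" by (simp add: insert_commute)
      have "g u \<noteq> g v" using g e unfolding P_def by blast
      moreover have "\<not> (g u = g x \<and> g v = g y)" "\<not> (g v = g x \<and> g u = g y)"
        using no e e' by blast+
      ultimately show "g' u \<noteq> g' v" unfolding g'_def by auto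
    next
      fix u v assume uv: "u \<in> ?V" "v \<in> ?V" "g' u = g' v"
      have ref: "c a = c b" if "a \<in> ?V" "b \<in> ?V" "g a = g b" for a b
        using g that unfolding P_def by blast
      show "c u = c v"
        using uv(3) ref[OF uv(1,2)] ref[OF uv(1) xy(1)] ref[OF uv(2) xy(1)]
          ref[OF uv(1) xy(2)] ref[OF uv(2) xy(2)] xy(3)
        unfolding g'_def by (auto split: if_splits)
    qed
    then have "card (g ` ?V) \<le> card (g' ` ?V)" by (rule min)
    also have "g' ` ?V \<subseteq> g ` ?V - {g x}" using xy unfolding g'_def by auto
    then have "card (g' ` ?V) \<le> card (g ` ?V - {g x})" using fin by (intro card_mono) auto
    also have "\<dots> < card (g ` ?V)" using fin xy by (intro card_Diff1_less) auto
    finally show False by simp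
  qed
  show ?thesis using g merge unfolding P_def by blast
qed

text \<open>Let a minimal proper refinement \<open>g\<close> split class \<open>i\<close> of
  \<open>c\<close> into k_i classes, s in total. Any two of these k_i classes are joined by an edge,
  which is monochromatic under \<open>c\<close>, so the sum of k_i (k_i - 1) is at most twice the
  number of such edges. By convexity the sum is at least s (s - q) / q, and s is at least the
  chromatic number since \<open>g\<close> is proper.\<close>

lemma card_mono_edges_ge:
  fixes c :: "'a \<Rightarrow> nat"
  assumes G: "fin_simple_graph G" and c: "c ` uverts G \<subseteq> {..<q}"
    and q: "0 < q" "q \<le> chromatic_number G"
  shows "(real (chromatic_number G) - real q)\<^sup>2 / (2 * real q) \<le> real (card (mono_edges G c))"
proof -
  let ?V = "uverts G"
  have fin: "finite ?V" using G by (simp add: fin_simple_graph_def)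
  obtain g :: "'a \<Rightarrow> nat" where proper: "\<And>u v. {u, v} \<in> uedges G \<Longrightarrow> g u \<noteq> g v"
    and ref: "\<And>u v. u \<in> ?V \<Longrightarrow> v \<in> ?V \<Longrightarrow> g u = g v \<Longrightarrow> c u = c v"
    and edge: "\<And>x y. x \<in> ?V \<Longrightarrow> y \<in> ?V \<Longrightarrow> c x = c y \<Longrightarrow> g x \<noteq> g y \<Longrightarrow>
      \<exists>u v. {u, v} \<in> uedges G \<and> g u = g x \<and> g v = g y"
    using ex_minimal_proper_refinement[OF G, of c] by blast
  define K where "K i = g ` {v \<in> ?V. c v = i}" for i
  define s where "s = card (g ` ?V)"
  define k where "k i = real (card (K i))" for i
  have finK: "finite (K i)" for i using fin by (simp add: K_def)
  \<comment> \<open>Two classes of \<open>c\<close> share no value of \<open>g\<close>, because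
    \<open>g\<close> refines \<open>c\<close>; hence the k_i add up to s.\<close>
  have disj: "K i \<inter> K j = {}" if "i \<noteq> j" for i j
  proof (rule ccontr)
    assume "K i \<inter> K j \<noteq> {}"
    then obtain u v where "u \<in> ?V" "v \<in> ?V" "c u = i" "c v = j" "g u = g v"
      unfolding K_def by auto
    then show False using ref[of u v] that by simp
  qed
  have "g ` ?V = (\<Union>i\<in>{..<q}. K i)" using c unfolding K_def by blast
  then have "s = (\<Sum>i<q. card (K i))"
    unfolding s_def using finK disj by (simp add: card_UN_disjoint)
  then have s: "real s = (\<Sum>i<q. k i)" by (simp add: k_def)
  have "card (\<Union>i\<in>{..<q}. K i \<times> K i - Id) = (\<Sum>i<q. card (K i \<times> K i - Id))"
  proof (rule card_UN_disjoint)
    show "\<forall>i\<in>{..<q}. \<forall>j\<in>{..<q}. i \<noteq> j \<longrightarrow> (K i \<times> K i - Id) \<inter> (K j \<times> K j - Id) = {}"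
      using disj by blast
  qed (auto simp: finK)
  then have sq: "real (card (\<Union>i\<in>{..<q}. K i \<times> K i - Id)) = (\<Sum>i<q. (k i)\<^sup>2 - k i)"
    by (simp add: card_Times_minus_Id[OF finK] k_def)
  let ?D = "{(u, v). {u, v} \<in> mono_edges G c}"
  have mE: "mono_edges G c \<subseteq> uedges G" by (auto simp: mono_edges_def)
  \<comment> \<open>Every ordered pair of distinct \<open>g\<close>-values within one class of
    \<open>c\<close> is realised by the ends of an oriented monochromatic edge.\<close>
  have "(\<Union>i\<in>{..<q}. K i \<times> K i - Id) \<subseteq> (\<lambda>(u, v). (g u, g v)) ` ?D"
  proof
    fix z assume "z \<in> (\<Union>i\<in>{..<q}. K i \<times> K i - Id)"
    then obtain i a b where "a \<in> K i" "b \<in> K i" "a \<noteq> b" "z = (a, b)" by auto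
    then obtain x y where xy: "x \<in> ?V" "y \<in> ?V" "c x = c y" "g x \<noteq> g y" "z = (g x, g y)"
      unfolding K_def by auto
    obtain u v where uv: "{u, v} \<in> uedges G" "g u = g x" "g v = g y"
      using edge[OF xy(1-4)] by blast
    have "u \<in> ?V" "v \<in> ?V" using uv(1) G unfolding fin_simple_graph_def by blast+
    then have "c u = c v" using ref[OF _ xy(1) uv(2)] ref[OF _ xy(2) uv(3)] xy(3) by simp
    then have "(u, v) \<in> ?D" using uv(1) by (auto simp: mono_edges_def)
    then show "z \<in> (\<lambda>(u, v). (g u, g v)) ` ?D"
      using uv(2,3) xy(5) by (intro image_eqI[where x = "(u, v)"]) auto
  qed
  then have "card (\<Union>i\<in>{..<q}. K i \<times> K i - Id) \<le> card ?D"
    using card_ordered_edges_le(2)[OF G mE] by (rule surj_card_le[rotated])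
  also have "\<dots> \<le> 2 * card (mono_edges G c)" by (rule card_ordered_edges_le(1)[OF G mE])
  finally have "(\<Sum>i<q. (k i)\<^sup>2 - k i) \<le> 2 * real (card (mono_edges G c))"
    using sq by linarith
  moreover
  let ?a = "real s / real q"
  \<comment> \<open>Convexity in tangent form: k^2 is bounded below by its tangent at the mean value
    s / q.\<close>
  have "(\<Sum>i<q. 2 * ?a * k i - ?a\<^sup>2 - k i) \<le> (\<Sum>i<q. (k i)\<^sup>2 - k i)"
  proof (rule sum_mono)
    fix i
    have "0 \<le> (k i - ?a)\<^sup>2" by simp
    then show "2 * ?a * k i - ?a\<^sup>2 - k i \<le> (k i)\<^sup>2 - k i" by (simp add: power2_diff algebra_simps)
  qed
  moreover have "(\<Sum>i<q. 2 * ?a * k i - ?a\<^sup>2 - k i) = 2 * ?a * real s - real q * ?a\<^sup>2 - real s"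
    by (simp only: sum_subtractf s flip: sum_distrib_left) simp
  moreover have "2 * ?a * real s - real q * ?a\<^sup>2 - real s = real s * (real s - real q) / real q"
    using q by (simp add: field_simps power2_eq_square)
  ultimately have "real s * (real s - real q) / real q \<le> 2 * real (card (mono_edges G c))"
    by linarith
  \<comment> \<open>Both factors on the right are at least the chromatic number minus q, since s is
    at least the chromatic number.\<close>
  moreover have "(real (chromatic_number G) - real q)\<^sup>2 \<le> real s * (real s - real q)"
  proof -
    have "chromatic_number G \<le> s"
      unfolding s_def by (rule chromatic_number_le_card_image[OF G proper])
    then show ?thesis unfolding power2_eq_square using q by (intro mult_mono) auto
  qed
  then have "(real (chromatic_number G) - real q)\<^sup>2 / real q \<le> real s * (real s - real q) / real q"
    by (rule divide_right_mono) simp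
  ultimately show ?thesis by simp
qed

section \<open>Number of edges of a cycle\<close>

text \<open>This makes p^l the probability that all edges of a given cycle of length l
  survive.\<close>

lemma card_cycle_edges:
  assumes "is_cycle l C"
  shows "card (uedges C) = l"
proof -
  obtain vs where vs: "length vs = l" "3 \<le> l" "distinct vs"
    and C: "C = (set vs, {{vs ! i, vs ! (Suc i mod l)} | i. i < l})"
    using assms unfolding is_cycle_def by blast
  have nth_eq: "vs ! i = vs ! j \<longleftrightarrow> i = j" if "i < l" "j < l" for i j
    using vs that by (simp add: nth_eq_iff_index_eq)
  have mod: "Suc i mod l = (if Suc i = l then 0 else Suc i)" if "i < l" for i
    using that by auto
  have "inj_on (\<lambda>i. {vs ! i, vs ! (Suc i mod l)}) {..<l}"
  proof (rule inj_onI)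
    fix i j assume ij: "i \<in> {..<l}" "j \<in> {..<l}"
      and eq: "{vs ! i, vs ! (Suc i mod l)} = {vs ! j, vs ! (Suc j mod l)}"
    have lt: "Suc i mod l < l" "Suc j mod l < l" using vs(2) by simp_all
    have "i = j \<or> (i = Suc j mod l \<and> Suc i mod l = j)"
      using eq ij lt by (auto simp: doubleton_eq_iff nth_eq)
    \<comment> \<open>In the second case \<open>i\<close> and \<open>j\<close> are cyclic successors
      of each other, which is impossible for \<open>3 \<le> l\<close>.\<close>
    then show "i = j" using ij vs(2) by (auto simp: mod split: if_splits)
  qed
  then have "card ((\<lambda>i. {vs ! i, vs ! (Suc i mod l)}) ` {..<l}) = l" by (simp add: card_image)
  moreover have "uedges C = (\<lambda>i. {vs ! i, vs ! (Suc i mod l)}) ` {..<l}" using C by auto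
  ultimately show ?thesis by simp
qed

section \<open>Random edge sets as finite weighted sums\<close>

text \<open>For \<open>S \<subseteq> E\<close> this is the probability that \<open>S\<close> is the
  outcome when each element of \<open>E\<close> is kept independently with probability
  \<open>p\<close>. Expectations are finite sums over \<open>Pow E\<close>.\<close>

definition bernoulli_weight :: "real \<Rightarrow> 'b set \<Rightarrow> 'b set \<Rightarrow> real" where
  "bernoulli_weight p E S = p ^ card S * (1 - p) ^ card (E - S)"

lemma bernoulli_weight_nonneg:
  assumes "0 \<le> p" "p \<le> 1"
  shows "0 \<le> bernoulli_weight p E S"
  using assms by (simp add: bernoulli_weight_def)

text \<open>In the expansion of the right-hand product, taking \<open>p * x e\<close> or
  \<open>1 - p\<close> for each \<open>e\<close> amounts to choosing \<open>S\<close>. So the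
  expectation of a multiplicative function of the random set factors over \<open>E\<close>.\<close>

lemma sum_bernoulli_weight_prod:
  assumes "finite E"
  shows "(\<Sum>S\<in>Pow E. bernoulli_weight p E S * (\<Prod>e\<in>S. x e)) = (\<Prod>e\<in>E. p * x e + (1 - p))"
  unfolding prod_add[OF assms, of "\<lambda>e. p * x e"] bernoulli_weight_def
  by (simp add: prod.distrib mult_ac)

lemma sum_bernoulli_weight:
  assumes "finite E"
  shows "(\<Sum>S\<in>Pow E. bernoulli_weight p E S) = 1"
  using sum_bernoulli_weight_prod[OF assms, of p "\<lambda>_. 1"] by simp

lemma sum_bernoulli_weight_half_power:
  assumes E: "finite E" and F: "F \<subseteq> E"
  shows "(\<Sum>S\<in>Pow E. bernoulli_weight p E S * (1 / 2) ^ card (S \<inter> F)) = (1 - p / 2) ^ card F"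
proof -
  have "(\<Prod>e\<in>S. if e \<in> F then 1 / 2 else 1 :: real) = (1 / 2) ^ card (S \<inter> F)" if "S \<in> Pow E" for S
  proof -
    have "finite S" using that E finite_subset by blast
    then show ?thesis by (simp flip: prod.inter_restrict)
  qed
  then have "(\<Sum>S\<in>Pow E. bernoulli_weight p E S * (1 / 2) ^ card (S \<inter> F))
    = (\<Sum>S\<in>Pow E. bernoulli_weight p E S * (\<Prod>e\<in>S. if e \<in> F then 1 / 2 else 1))"
    by (intro sum.cong) simp_all
  also have "\<dots> = (\<Prod>e\<in>E. p * (if e \<in> F then 1 / 2 else 1) + (1 - p))"
    by (rule sum_bernoulli_weight_prod[OF E])
  also have "\<dots> = (\<Prod>e\<in>E. if e \<in> F then 1 - p / 2 else 1)"
    by (intro prod.cong) auto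
  also have "\<dots> = (\<Prod>e\<in>E \<inter> F. 1 - p / 2)" using E by (simp only: prod.inter_restrict)
  also have "\<dots> = (1 - p / 2) ^ card F" using F by (simp add: Int_absorb1)
  finally show ?thesis .
qed

lemma sum_bernoulli_weight_superset:
  assumes E: "finite E" and A: "A \<subseteq> E"
  shows "(\<Sum>S\<in>Pow E. bernoulli_weight p E S * of_bool (A \<subseteq> S)) = p ^ card A"
proof -
  \<comment> \<open>The event that \<open>A\<close> survives is encoded in the factors of the
    removed elements: removing an element of \<open>A\<close> contributes 0.\<close>
  have "(\<Prod>e\<in>E - S. if e \<in> A then 0 else 1 - p) = (1 - p) ^ card (E - S) * of_bool (A \<subseteq> S)" for S
  proof (cases "A \<subseteq> S")
    case True
    then have "(\<Prod>e\<in>E - S. if e \<in> A then 0 else 1 - p) = (\<Prod>e\<in>E - S. 1 - p)"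
      by (intro prod.cong) auto
    then show ?thesis using True by simp
  next
    case False
    then show ?thesis using A E by (auto simp: prod_zero_iff)
  qed
  then have "(\<Sum>S\<in>Pow E. bernoulli_weight p E S * of_bool (A \<subseteq> S))
    = (\<Sum>S\<in>Pow E. (\<Prod>e\<in>S. p) * (\<Prod>e\<in>E - S. if e \<in> A then 0 else 1 - p))"
    unfolding bernoulli_weight_def by (intro sum.cong) simp_all
  also have "\<dots> = (\<Prod>e\<in>E. p + (if e \<in> A then 0 else 1 - p))"
    by (rule prod_add[OF E, symmetric])
  also have "\<dots> = (\<Prod>e\<in>E. if e \<in> A then p else 1)"
    by (intro prod.cong) auto
  also have "\<dots> = (\<Prod>e\<in>E \<inter> A. p)" using E by (simp only: prod.inter_restrict)
  also have "\<dots> = p ^ card A" using A by (simp add: Int_absorb1)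
  finally show ?thesis .
qed

text \<open>A value whose average is below 1 is below 1 at some \<open>S\<close>. There it is a sum
  of nonnegative terms, so each term is below 1, which gives both the bound on contained sets and
  each lower bound on the intersections.\<close>

lemma ex_subset_few_contained_many_hit:
  fixes E :: "'b set" and A :: "'z \<Rightarrow> 'b set" and F :: "'k \<Rightarrow> 'b set" and p t :: real
  assumes fin: "finite E" "finite Z" "finite K"
    and A: "\<And>z. z \<in> Z \<Longrightarrow> A z \<subseteq> E" and F: "\<And>c. c \<in> K \<Longrightarrow> F c \<subseteq> E"
    and p: "0 \<le> p" "p \<le> 1" and t: "0 < t"
    and less: "(\<Sum>z\<in>Z. p ^ card (A z)) / t + 2 powr t * (\<Sum>c\<in>K. (1 - p / 2) ^ card (F c)) < 1"
  shows "\<exists>S\<subseteq>E. real (card {z \<in> Z. A z \<subseteq> S}) < t \<and> (\<forall>c\<in>K. t < real (card (S \<inter> F c)))"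
proof -
  let ?w = "bernoulli_weight p E"
  define Y where "Y S = (\<Sum>z\<in>Z. of_bool (A z \<subseteq> S) :: real)" for S
  define X where "X S = (\<Sum>c\<in>K. (1 / 2 :: real) ^ card (S \<inter> F c))" for S
  have Y: "(\<Sum>S\<in>Pow E. ?w S * Y S) = (\<Sum>z\<in>Z. p ^ card (A z))"
    unfolding Y_def sum_distrib_left sum.swap[of _ Z]
    by (intro sum.cong refl sum_bernoulli_weight_superset fin A)
  have X: "(\<Sum>S\<in>Pow E. ?w S * X S) = (\<Sum>c\<in>K. (1 - p / 2) ^ card (F c))"
    unfolding X_def sum_distrib_left sum.swap[of _ K]
    by (intro sum.cong refl sum_bernoulli_weight_half_power fin F)
  have "(\<Sum>S\<in>Pow E. ?w S * (Y S / t + 2 powr t * X S))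
    = (\<Sum>S\<in>Pow E. ?w S * Y S) / t + 2 powr t * (\<Sum>S\<in>Pow E. ?w S * X S)"
    by (simp add: sum.distrib sum_distrib_left sum_divide_distrib algebra_simps)
  also have "\<dots> < (\<Sum>S\<in>Pow E. ?w S)"
    unfolding X Y sum_bernoulli_weight[OF fin(1)] by (rule less)
  finally have "\<not> (\<Sum>S\<in>Pow E. ?w S) \<le> (\<Sum>S\<in>Pow E. ?w S * (Y S / t + 2 powr t * X S))"
    by simp
  \<comment> \<open>If the bracket were at least 1 for every \<open>S\<close>, nonnegativity of the
    weights and their total 1 would make the average at least 1.\<close>
  then have "\<not> (\<forall>S\<in>Pow E. ?w S * 1 \<le> ?w S * (Y S / t + 2 powr t * X S))"
    using sum_mono[of "Pow E" ?w "\<lambda>S. ?w S * (Y S / t + 2 powr t * X S)"] by fastforce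
  then obtain S where S: "S \<subseteq> E" and small: "Y S / t + 2 powr t * X S < 1"
    using mult_left_mono[OF _ bernoulli_weight_nonneg[OF p]] by (meson PowD not_le)
  have X0: "0 \<le> X S" and Y0: "0 \<le> Y S" by (simp_all add: X_def Y_def sum_nonneg)
  have "Y S / t < 1" using small X0 by (smt (verit) mult_nonneg_nonneg powr_ge_zero)
  then have "Y S < t" using t by simp
  moreover have "Y S = real (card {z \<in> Z. A z \<subseteq> S})"
    unfolding Y_def using fin(2) by (simp add: sum.If_cases of_bool_def Int_def)
  moreover have "t < real (card (S \<inter> F c))" if c: "c \<in> K" for c
  proof -
    let ?k = "card (S \<inter> F c)"
    \<comment> \<open>A single nonnegative summand of \<open>X S\<close> is at most the whole sum,
      so one bound serves all \<open>c\<close> at once.\<close>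
    have "(1 / 2) ^ ?k \<le> X S" unfolding X_def using c fin(3)
      by (intro member_le_sum) auto
    then have "2 powr t * (1 / 2) ^ ?k \<le> 2 powr t * X S" by (intro mult_left_mono) auto
    also have "\<dots> < 1" using small Y0 t by (smt (verit) divide_nonneg_pos)
    finally have "2 powr t < 2 ^ ?k" by (simp add: power_one_over field_simps)
    also have "(2::real) ^ ?k = 2 powr real ?k" by (simp add: powr_realpow)
    finally show ?thesis by simp
  qed
  ultimately show ?thesis using S by auto
qed

section \<open>Numerical estimates\<close>

text \<open>Each summand is at most 1/4. In the second one, the factors are bounded by exp (T/4),
  exp (T/16) / 4 and exp (-T/2), whose exponents add up to -3T/16. It is applied with T = p M, so
  that T/4 is the threshold t.\<close>

lemma union_bound_less_one:
  fixes T :: real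
  assumes T: "0 < T" "16 * (real n * ln (real q) + ln 4) \<le> T" and q: "q \<ge> 1"
    and Y: "Y \<le> T / 16" and B: "B \<le> exp (- T / 2)"
  shows "Y / (T / 4) + 2 powr (T / 4) * (real (q ^ n) * B) < 1"
proof -
  have "Y / (T / 4) \<le> 1 / 4" using T Y by (simp add: field_simps)
  moreover have "2 powr (T / 4) * (real (q ^ n) * B) \<le> 1 / 4"
  proof -
    have "ln 2 \<le> (1::real)" using ln_le_minus_one[of "2::real"] by simp
    then have two: "2 powr (T / 4) \<le> exp (T / 4)" using T by (simp add: powr_def)
    \<comment> \<open>The term \<open>ln 4\<close> in the hypothesis provides the factor 4 here,
      hence the final 1/4.\<close>
    have "4 * real (q ^ n) = exp (real n * ln (real q) + ln 4)"
      using q by (simp add: exp_add exp_of_nat_mult)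
    also have "\<dots> \<le> exp (T / 16)" using T by simp
    finally have qn: "real (q ^ n) \<le> exp (T / 16) / 4" by simp
    have "real (q ^ n) * B \<le> real (q ^ n) * exp (- T / 2)" using B by (intro mult_left_mono) auto
    also have "\<dots> \<le> exp (T / 16) / 4 * exp (- T / 2)" using qn by (intro mult_right_mono) auto
    finally have "2 powr (T / 4) * (real (q ^ n) * B)
      \<le> 2 powr (T / 4) * (exp (T / 16) / 4 * exp (- T / 2))" by (intro mult_left_mono) auto
    also have "\<dots> \<le> exp (T / 4) * (exp (T / 16) / 4 * exp (- T / 2))"
      using two by (intro mult_right_mono) auto
    also have "\<dots> = exp (T / 4 + (T / 16 + - T / 2)) / 4"
      by (simp only: exp_add times_divide_eq_left times_divide_eq_right)
    also have "\<dots> \<le> 1 / 4" using T by simp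
    finally show ?thesis .
  qed
  ultimately show ?thesis by linarith
qed

lemma one_minus_half_power_le_exp:
  fixes p M :: real
  assumes "0 \<le> p" "p \<le> 1" "M \<le> real k"
  shows "(1 - p / 2) ^ k \<le> exp (- (p * M) / 2)"
proof -
  have "(1 - p / 2) ^ k \<le> exp (- (p / 2)) ^ k"
    using assms exp_ge_add_one_self[of "- (p / 2)"] by (intro power_mono) auto
  also have "\<dots> = exp (- (p / 2) * real k)" by (rule exp_of_nat2_mult[symmetric])
  also have "\<dots> \<le> exp (- (p * M) / 2)" using assms by (simp add: mult_left_mono)
  finally show ?thesis .
qed

section \<open>Choosing an outcome and deleting edges\<close>

theorem theorem3p1:
  fixes r q n m :: nat and J :: "'a ugraph" and p M :: real
  assumes "r \<ge> 4" and "q \<ge> 1"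
    and "fin_simple_graph J"
    and "n = card (uverts J)"
    and "m = chromatic_number J" and "m > q"
    and "M = (real m - real q)\<^sup>2 / (2 * real q)"
    and "0 < p" and "p \<le> 1"
    and "p * M \<ge> 16 * (real n * ln (real q) + ln 4)"
    and "(\<Sum>l = 3..r - 1. p ^ l * real (cycle_count l J)) \<le> p * M / 16"
  shows "\<exists>H. subgraph_of H J \<and> girth H \<ge> enat r \<and> chromatic_number H \<ge> q + 1"
proof -
  note J = \<open>fin_simple_graph J\<close>
  let ?V = "uverts J" and ?E = "uedges J"
  define Cyc where "Cyc l = {C. subgraph_of C J \<and> is_cycle l C}" for l
  \<comment> \<open>Pairing each cycle with its length lets a sum over \<open>Z\<close> split by
    length.\<close>
  define Z where "Z = (SIGMA l:{3..r - 1}. Cyc l)"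
  define A where "A z = uedges (snd z)" for z :: "nat \<times> 'a ugraph"
  \<comment> \<open>Extensional functions are used so that there are exactly q^n colour
    maps.\<close>
  define K where "K = ?V \<rightarrow>\<^sub>E {..<q}"
  have finV: "finite ?V" using J by (simp add: fin_simple_graph_def)
  have finCyc: "finite (Cyc l)" for l
    unfolding Cyc_def by (rule finite_subset[OF _ finite_subgraphs[OF J]]) auto
  have finZ: "finite Z" unfolding Z_def by (intro finite_SigmaI finCyc) auto
  have finK: "finite K" unfolding K_def by (intro finite_PiE finV) auto
  have cardK: "card K = q ^ n" unfolding K_def using finV assms(4) by (simp add: card_PiE)
  have M: "0 < M" using assms by simp
  have mono: "M \<le> real (card (mono_edges J c))" if "c \<in> K" for c
    using card_mono_edges_ge[OF J, of c q] that assms by (auto simp: K_def)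
  have "(\<Sum>z\<in>Z. p ^ card (A z)) = (\<Sum>l=3..r - 1. \<Sum>C\<in>Cyc l. p ^ card (uedges C))"
    unfolding Z_def A_def by (subst sum.Sigma) (auto simp: finCyc case_prod_beta)
  also have "\<dots> = (\<Sum>l=3..r - 1. \<Sum>C\<in>Cyc l. p ^ l)"
    by (intro sum.cong refl) (auto simp: Cyc_def dest: card_cycle_edges)
  also have "\<dots> \<le> p * M / 16"
    using assms(11) by (simp add: cycle_count_def Cyc_def mult.commute)
  finally have Zbound: "(\<Sum>z\<in>Z. p ^ card (A z)) \<le> p * M / 16" .
  have "(\<Sum>z\<in>Z. p ^ card (A z)) / (p * M / 4)
    + 2 powr (p * M / 4) * (\<Sum>c\<in>K. (1 - p / 2) ^ card (mono_edges J c)) < 1"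
  proof -
    have "(\<Sum>c\<in>K. (1 - p / 2) ^ card (mono_edges J c)) \<le> real (card K) * exp (- (p * M) / 2)"
      using mono assms(8,9) by (intro sum_bounded_above one_minus_half_power_le_exp) auto
    then have "2 powr (p * M / 4) * (\<Sum>c\<in>K. (1 - p / 2) ^ card (mono_edges J c))
      \<le> 2 powr (p * M / 4) * (real (q ^ n) * exp (- (p * M) / 2))"
      unfolding cardK by (intro mult_left_mono) auto
    moreover have "(\<Sum>z\<in>Z. p ^ card (A z)) / (p * M / 4)
      + 2 powr (p * M / 4) * (real (q ^ n) * exp (- (p * M) / 2)) < 1"
      using M assms(8) by (intro union_bound_less_one[OF _ assms(10,2) Zbound]) auto
    ultimately show ?thesis by linarith
  qed
  then obtain S where S: "S \<subseteq> ?E" and few: "real (card {z \<in> Z. A z \<subseteq> S}) < p * M / 4"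
    and many: "\<And>c. c \<in> K \<Longrightarrow> p * M / 4 < real (card (S \<inter> mono_edges J c))"
    using ex_subset_few_contained_many_hit[of ?E Z K A "mono_edges J" p "p * M / 4"]
      finite_uedges[OF J] finZ finK assms(8,9) M
    by (auto simp: Z_def A_def Cyc_def subgraph_of_def mono_edges_def)
  \<comment> \<open>\<open>e\<close> picks the edge to delete from each short cycle; the choice is
    meaningful because a cycle has at least 3 edges.\<close>
  define e where "e z = (SOME x. x \<in> A z)" for z
  define D where "D = e ` {z \<in> Z. A z \<subseteq> S}"
  have e: "e z \<in> A z" if "z \<in> Z" for z
  proof -
    obtain l C where z: "z = (l, C)" "3 \<le> l" "is_cycle l C"
      using \<open>z \<in> Z\<close> by (auto simp: Z_def Cyc_def)
    then have "card (A z) \<noteq> 0" using card_cycle_edges[of l C] by (simp add: A_def)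
    then have "A z \<noteq> {}" by auto
    then show ?thesis unfolding e_def by (simp add: some_in_eq)
  qed
  have finD: "finite D" unfolding D_def using finZ by simp
  have cardD: "card D \<le> card {z \<in> Z. A z \<subseteq> S}"
    unfolding D_def using finZ by (intro card_image_le) simp
  \<comment> \<open>All vertices are kept, so a colouring of \<open>H\<close> restricts to a map on
    the whole vertex set of \<open>J\<close>.\<close>
  define H where "H = (?V, S - D)"
  have HJ: "subgraph_of H J"
    using J S unfolding H_def subgraph_of_def fin_simple_graph_def by auto
  have "enat r \<le> girth H" unfolding girth_def
  \<comment> \<open>Bounding every cycle length from below also covers a forest, where the infimum
    is infinite.\<close>
  proof (rule INF_greatest, clarify)
    fix l C1 C2 assume C: "subgraph_of (C1, C2) H" "is_cycle l (C1, C2)"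
    let ?C = "(C1, C2)"
    show "enat r \<le> enat l"
    proof (rule ccontr)
      assume "\<not> enat r \<le> enat l"
      then have "l \<in> {3..r - 1}" using C(2) by (auto simp: is_cycle_def)
      moreover have "subgraph_of ?C J" using C(1) HJ by (auto simp: subgraph_of_def)
      ultimately have z: "(l, ?C) \<in> Z" using C(2) by (simp add: Z_def Cyc_def)
      \<comment> \<open>A short cycle of \<open>H\<close> would have all its edges in
        \<open>S\<close>, so its chosen edge was deleted and cannot belong to
        \<open>H\<close>.\<close>
      have sub: "A (l, ?C) \<subseteq> S - D" using C(1) by (simp add: A_def H_def subgraph_of_def)
      then have "e (l, ?C) \<in> D" using z unfolding D_def by blast
      then show False using e[OF z] sub by blast
    qed
  qed
  moreover have "q + 1 \<le> chromatic_number H"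
  proof (rule ccontr)
    assume "\<not> q + 1 \<le> chromatic_number H"
    moreover obtain f where f: "proper_coloring H (chromatic_number H) f"
      using ex_chromatic_coloring[of H] HJ by (auto simp: subgraph_of_def)
    ultimately have c: "restrict f ?V \<in> K"
      unfolding K_def proper_coloring_def H_def by fastforce
    \<comment> \<open>Fewer than t edges are deleted but more than t surviving edges are
      monochromatic, so one of the latter remains in \<open>H\<close>.\<close>
    have "card D < card (S \<inter> mono_edges J (restrict f ?V))"
      using few many[OF c] cardD by linarith
    then have "\<not> S \<inter> mono_edges J (restrict f ?V) \<subseteq> D"
      using card_mono[OF finD] by (meson not_le)
    then obtain x where x: "x \<in> S - D" "x \<in> mono_edges J (restrict f ?V)" by blast
    then have "x \<in> ?E" using S by blast
    then have "card x = 2" and xV: "x \<subseteq> ?V" using J unfolding fin_simple_graph_def by auto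
    then obtain u v where uv: "x = {u, v}" by (meson card_2_iff)
    have "restrict f ?V u = restrict f ?V v" using x(2) unfolding mono_edges_def uv by blast
    then have "f u = f v" using xV unfolding uv by simp
    moreover have "{u, v} \<in> uedges H" using x(1) uv by (simp add: H_def)
    ultimately show False using f unfolding proper_coloring_def by blast
  qed
  ultimately show ?thesis using HJ by blast
qed

end
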